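(* Stallings' group $$S = \langle a,b,c,d,e \mid a^b=a^c=a^d=a^e,\ [c,d]=[d,b]=[e,c]=[e,b]=1\rangle$$ satisfies a cubic isoperimetric inequality: there is a constant $K>0$ such that every word $w$ of length $n\geq 1$ in the generators $a,b,c,d,e$ and their inverses that represents the identity in $S$ is freely equal to a product of at most $Kn^3$ conjugates of the defining relators and their inverses.
   Context: Notation: $x^y=y^{-1}xy$ and $[x,y]=x^{-1}y^{-1}xy$. The chain of equalities $a^b=a^c=a^d=a^e$ stands for the relators $a^b(a^c)^{-1}$, etc., asserting that these four conjugates of $a$ are all equal. *)

theory Defs
  imports Complex_Main "HOL-Algebra.Generated_Groups"
begin

section \<open>Words and free equality\<close>

text \<open>A letter is a generator with a sign: \<open>(x, True)\<close> is \<open>x\<close> and \<open>(x, False)\<close> is its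
  formal inverse. Words need not be reduced, so \<open>length\<close> counts all letters.\<close>

type_synonym 'g word = "('g \<times> bool) list"

definition inv_word :: "'g word \<Rightarrow> 'g word" where
  "inv_word w = map (\<lambda>(x, s). (x, \<not> s)) (rev w)"

inductive cancel_step :: "'g word \<Rightarrow> 'g word \<Rightarrow> bool" where
  "cancel_step (u @ [(x, s), (x, \<not> s)] @ v) (u @ v)"

abbreviation freely_equal :: "'g word \<Rightarrow> 'g word \<Rightarrow> bool" where
  "freely_equal \<equiv> equivclp cancel_step"

definition conj_word :: "'g word \<Rightarrow> 'g word \<Rightarrow> 'g word" where
  "conj_word x y = inv_word y @ x @ y"

definition comm_word :: "'g word \<Rightarrow> 'g word \<Rightarrow> 'g word" where
  "comm_word x y = inv_word x @ inv_word y @ x @ y"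


section \<open>Free groups and group presentations\<close>

definition free_class :: "'g word \<Rightarrow> 'g word set" where
  "free_class w = {v. freely_equal w v}"

definition free_group :: "'g word set monoid" where
  "free_group =
     \<lparr>carrier = range free_class,
      mult = (\<lambda>X Y. \<Union>u\<in>X. \<Union>v\<in>Y. free_class (u @ v)),
      one = free_class []\<rparr>"

definition normal_closure :: "('a, 'b) monoid_scheme \<Rightarrow> 'a set \<Rightarrow> 'a set" where
  "normal_closure G X = \<Inter>{N. N \<lhd> G \<and> X \<subseteq> N}"

definition relator_subgroup :: "'g word set \<Rightarrow> 'g word set set" where
  "relator_subgroup R = normal_closure free_group (free_class ` R)"

definition presented_group :: "'g word set \<Rightarrow> 'g word set set monoid" where
  "presented_group R = free_group Mod relator_subgroup R"

definition word_value :: "'g word set \<Rightarrow> 'g word \<Rightarrow> 'g word set set" where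
  "word_value R w = relator_subgroup R #>\<^bsub>free_group\<^esub> free_class w"

text \<open>A list of pairs \<open>(r, y)\<close> encodes the product of the conjugates \<open>r\<^sup>y\<close>.\<close>

definition conj_product :: "('g word \<times> 'g word) list \<Rightarrow> 'g word" where
  "conj_product ps = concat (map (\<lambda>(r, y). conj_word r y) ps)"


section \<open>Stallings' group\<close>

datatype gen = gen_a | gen_b | gen_c | gen_d | gen_e

abbreviation letter :: "'g \<Rightarrow> 'g word" where
  "letter x \<equiv> [(x, True)]"

text \<open>The chain \<open>a\<^sup>b = a\<^sup>c = a\<^sup>d = a\<^sup>e\<close> contributes one relator for each of its three
  equality signs.\<close>

definition stallings_relators :: "gen word set" where
  "stallings_relators =
    (let a = letter gen_a; b = letter gen_b; c = letter gen_c; d = letter gen_d; e = letter gen_e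
     in {conj_word a b @ inv_word (conj_word a c),
         conj_word a c @ inv_word (conj_word a d),
         conj_word a d @ inv_word (conj_word a e),
         comm_word c d, comm_word d b, comm_word e c, comm_word e b})"

definition stallings_group :: "gen word set set monoid" where
  "stallings_group = presented_group stallings_relators"


section \<open>Well-definedness\<close>

lemma free_class_eq_iff: "free_class u = free_class v \<longleftrightarrow> freely_equal u v"
proof
  assume "free_class u = free_class v"
  then have "v \<in> free_class u" by (simp add: free_class_def)
  then show "freely_equal u v" by (simp add: free_class_def)
next
  assume "freely_equal u v"
  then show "free_class u = free_class v"
    unfolding free_class_def by (blast intro: equivclp_trans equivclp_sym)
qed

lemma freely_equal_context:
  assumes "freely_equal u v"
  shows "freely_equal (p @ u @ q) (p @ v @ q)"
  using assms
proof (induction rule: equivclp_induct)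
  case base
  show ?case by simp
next
  case (step y z)
  have ctx: "cancel_step (p @ y' @ q) (p @ z' @ q)" if "cancel_step y' z'" for y' z' :: "'a word"
    using that
  proof cases
    case (1 l x s r)
    then show ?thesis using cancel_step.intros[of "p @ l" x s "r @ q"] by simp
  qed
  from step.hyps(2) have "freely_equal (p @ y @ q) (p @ z @ q)"
    using ctx by blast
  with step.IH show ?case by (rule equivclp_trans)
qed

lemma freely_equal_append:
  assumes "freely_equal u u'" "freely_equal v v'"
  shows "freely_equal (u @ v) (u' @ v')"
proof (rule equivclp_trans)
  show "freely_equal (u @ v) (u' @ v)"
    using freely_equal_context[OF assms(1), of "[]" v] by simp
  show "freely_equal (u' @ v) (u' @ v')"
    using freely_equal_context[OF assms(2), of u' "[]"] by simp
qed

lemma mult_free_group: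
  "free_class u \<otimes>\<^bsub>free_group\<^esub> free_class v = free_class (u @ v)"
proof -
  have eq: "free_class (u' @ v') = free_class (u @ v)"
    if "u' \<in> free_class u" "v' \<in> free_class v" for u' v'
  proof -
    from that have "freely_equal (u @ v) (u' @ v')"
      unfolding free_class_def by (intro freely_equal_append) simp_all
    then show ?thesis unfolding free_class_eq_iff by (rule equivclp_sym)
  qed
  have "w \<in> free_class w" for w :: "'a word"
    by (simp add: free_class_def)
  then have ne: "free_class u \<noteq> {}" "free_class v \<noteq> {}"
    by (metis empty_iff)+
  have "free_class u \<otimes>\<^bsub>free_group\<^esub> free_class v =
        (\<Union>u'\<in>free_class u. \<Union>v'\<in>free_class v. free_class (u' @ v'))"
    by (simp add: free_group_def)
  also have "\<dots> = (\<Union>u'\<in>free_class u. \<Union>v'\<in>free_class v. free_class (u @ v))"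
    by (intro SUP_cong refl eq)
  also have "\<dots> = free_class (u @ v)"
    using ne by simp
  finally show ?thesis .
qed

lemma freely_equal_inv_word: "freely_equal (inv_word w @ w) []"
proof (induction w)
  case Nil
  show ?case by (simp add: inv_word_def)
next
  case (Cons l w)
  obtain x s where l: "l = (x, s)" by fastforce
  have "cancel_step (inv_word w @ [(x, \<not> s), (x, \<not> \<not> s)] @ w) (inv_word w @ w)"
    by (rule cancel_step.intros)
  then have "freely_equal (inv_word (l # w) @ l # w) (inv_word w @ w)"
    by (intro r_into_equivclp) (simp add: inv_word_def l)
  then show ?case using Cons.IH by (rule equivclp_trans)
qed

lemma group_free_group: "group (free_group :: 'g word set monoid)"
proof (rule groupI)
  fix X :: "'g word set" assume "X \<in> carrier free_group"
  then obtain w where X: "X = free_class w" by (auto simp: free_group_def)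
  have "free_class (inv_word w) \<otimes>\<^bsub>free_group\<^esub> X = \<one>\<^bsub>free_group\<^esub>"
    unfolding X mult_free_group
    using freely_equal_inv_word[of w] by (simp add: free_class_eq_iff free_group_def)
  then show "\<exists>Y\<in>carrier free_group. Y \<otimes>\<^bsub>free_group\<^esub> X = \<one>\<^bsub>free_group\<^esub>"
    by (auto simp: free_group_def)
next
  fix X Y :: "'g word set" assume "X \<in> carrier free_group" "Y \<in> carrier free_group"
  then obtain u v where X: "X = free_class u" "Y = free_class v" by (auto simp: free_group_def)
  show "X \<otimes>\<^bsub>free_group\<^esub> Y \<in> carrier free_group"
    unfolding X mult_free_group by (simp add: free_group_def)
next
  show "\<one>\<^bsub>free_group\<^esub> \<in> carrier (free_group :: 'g word set monoid)"
    by (simp add: free_group_def)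
next
  fix X Y Z :: "'g word set"
  assume "X \<in> carrier free_group" "Y \<in> carrier free_group" "Z \<in> carrier free_group"
  then obtain u v w where "X = free_class u" "Y = free_class v" "Z = free_class w"
    by (auto simp: free_group_def)
  then show "X \<otimes>\<^bsub>free_group\<^esub> Y \<otimes>\<^bsub>free_group\<^esub> Z = X \<otimes>\<^bsub>free_group\<^esub> (Y \<otimes>\<^bsub>free_group\<^esub> Z)"
    by (simp add: mult_free_group)
next
  fix X :: "'g word set" assume "X \<in> carrier free_group"
  then obtain w where X: "X = free_class w" by (auto simp: free_group_def)
  have "\<one>\<^bsub>free_group\<^esub> = free_class ([] :: 'g word)" by (simp add: free_group_def)
  then show "\<one>\<^bsub>free_group\<^esub> \<otimes>\<^bsub>free_group\<^esub> X = X"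
    by (simp add: X mult_free_group)
qed

lemma (in group) normal_closure_normal:
  assumes "X \<subseteq> carrier G"
  shows "normal_closure G X \<lhd> G"
proof (rule normal_invI)
  have ne: "{N. N \<lhd> G \<and> X \<subseteq> N} \<noteq> {}"
    using normal_self assms by auto
  show "subgroup (normal_closure G X) G"
    unfolding normal_closure_def
    by (rule subgroups_Inter[OF _ ne]) (auto intro: normal_imp_subgroup)
  show "g \<otimes> h \<otimes> inv g \<in> normal_closure G X"
    if "g \<in> carrier G" "h \<in> normal_closure G X" for g h
    using that unfolding normal_closure_def
    by (auto intro: normal.inv_op_closed2)
qed

lemma relator_subgroup_normal: "relator_subgroup R \<lhd> free_group"
  unfolding relator_subgroup_def
  by (rule group.normal_closure_normal[OF group_free_group]) (auto simp: free_group_def)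

lemma group_presented_group: "group (presented_group R)"
  unfolding presented_group_def
  by (rule normal.factorgroup_is_group[OF relator_subgroup_normal])

lemma word_value_closed: "word_value R w \<in> carrier (presented_group R)"
  unfolding word_value_def presented_group_def FactGroup_def RCOSETS_def
  by (auto simp: free_group_def)

lemma word_value_append:
  "word_value R (u @ v) = word_value R u \<otimes>\<^bsub>presented_group R\<^esub> word_value R v"
  using normal.rcos_sum[OF relator_subgroup_normal, of "free_class u" "free_class v" R]
  by (simp add: word_value_def presented_group_def FactGroup_def mult_free_group)
     (simp add: free_group_def)

lemma word_value_relator:
  assumes "r \<in> R"
  shows "word_value R r = \<one>\<^bsub>presented_group R\<^esub>"
proof -
  have "free_class r \<in> relator_subgroup R"
    using assms unfolding relator_subgroup_def normal_closure_def by auto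
  then show ?thesis
    unfolding word_value_def presented_group_def FactGroup_def
    using subgroup.rcos_const[OF normal_imp_subgroup[OF relator_subgroup_normal] group_free_group]
    by simp
qed

end

theory Submission
  imports Defs
begin

text \<open>In \<open>S\<close> the letter \<open>a\<close> commutes with every word in \<open>b, c, d, e\<close> of exponent sum \<open>0\<close>.
  A null word \<open>w\<close> becomes trivial in the free group on \<open>a\<close> and \<open>t\<close> when \<open>b, c, d, e\<close> are all sent
  to \<open>t\<close>, so if \<open>a\<close> occurs in \<open>w\<close>, then \<open>w\<close> has a subword \<open>a\<^sup>\<plusminus>\<^sup>1 u a\<^sup>\<mp>\<^sup>1\<close> where \<open>u\<close> is free of \<open>a\<close>
  and has exponent sum \<open>0\<close>. Replacing this subword by \<open>u\<close> costs \<open>O(n\<^sup>2)\<close> relators: after sorting,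
  \<open>u = u\<^sub>1 u\<^sub>2\<close> with \<open>u\<^sub>1\<close> a word in \<open>b, c\<close> of exponent sum \<open>k\<close> and \<open>u\<^sub>2\<close> a word in \<open>d, e\<close>, and
  \<open>u\<close> is freely equal to \<open>(u\<^sub>1 d\<^sup>-\<^sup>k) (d\<^sup>k b\<^sup>-\<^sup>k) (b\<^sup>k u\<^sub>2)\<close>, each factor of which commutes with \<open>a\<close> at
  quadratic cost. At most \<open>n / 2\<close> such steps remove all letters \<open>a\<close>, leaving a null word in the
  product of the free groups on \<open>b, c\<close> and on \<open>d, e\<close>, which is sorted at quadratic cost.\<close>

section \<open>Reduction in free groups\<close>

lemma inv_word_simps [simp]:
  "inv_word [] = []"
  "inv_word (l # w) = inv_word w @ [(fst l, \<not> snd l)]"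
  "inv_word (u @ v) = inv_word v @ inv_word u"
  "length (inv_word w) = length w"
  by (auto simp: inv_word_def split: prod.splits)

lemma inv_word_inv_word [simp]: "inv_word (inv_word w) = w"
  by (induction w) auto

lemma freely_equal_inv_word_right: "freely_equal (w @ inv_word w) []"
  using freely_equal_inv_word[of "inv_word w"] by simp

lemma freely_equal_cancel:
  "freely_equal (p @ x @ inv_word x @ q) (p @ q)"
  "freely_equal (p @ inv_word x @ x @ q) (p @ q)"
  using freely_equal_context[OF freely_equal_inv_word_right[of x], of p q]
    freely_equal_context[OF freely_equal_inv_word[of x], of p q] by simp_all

lemma freely_equal_inv_word_cong:
  assumes "freely_equal u v"
  shows "freely_equal (inv_word u) (inv_word v)"
proof -
  have "freely_equal (inv_word u) (inv_word u @ v @ inv_word v)"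
    using freely_equal_cancel(1)[of "inv_word u" v "[]"] by (simp add: equivclp_sym)
  also have "freely_equal \<dots> (inv_word u @ u @ inv_word v)"
    using freely_equal_context[OF equivclp_sym[OF assms]] .
  also have "freely_equal \<dots> (inv_word v)"
    using freely_equal_cancel(2)[of "[]" u "inv_word v"] by simp
  finally (equivclp_trans) show ?thesis .
qed

definition cancelling :: "'g \<times> bool \<Rightarrow> 'g \<times> bool \<Rightarrow> bool" where
  "cancelling l m \<longleftrightarrow> fst l = fst m \<and> snd l \<noteq> snd m"

abbreviation reduced :: "'g word \<Rightarrow> bool" where
  "reduced \<equiv> successively (\<lambda>l m. \<not> cancelling l m)"

fun push :: "'g \<times> bool \<Rightarrow> 'g word \<Rightarrow> 'g word" where
  "push l [] = [l]"
| "push l (m # w) = (if cancelling l m then w else l # m # w)"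

text \<open>Letters are pushed from right to left onto an already reduced word, so a new letter can
  cancel only with its head.\<close>

definition reduce :: "'g word \<Rightarrow> 'g word" where
  "reduce w = foldr push w []"

lemma reduced_push: "reduced w \<Longrightarrow> reduced (push l w)"
  by (cases w) (auto simp: successively_Cons)

lemma reduced_reduce: "reduced (reduce w)"
  unfolding reduce_def by (induction w) (auto intro: reduced_push)

text \<open>This makes normal forms unique: inserting a cancelling pair is undone by two pushes, so
  \<open>reduce\<close> is constant on classes of free equality.\<close>

lemma push_push: "reduced w \<Longrightarrow> push (x, s) (push (x, \<not> s) w) = w"
proof (cases w)
  case (Cons m w')
  assume "reduced w"
  then show ?thesis
    by (cases m; cases w') (auto simp: Cons cancelling_def successively_Cons)
qed (simp add: cancelling_def)

lemma reduce_cong: "freely_equal u v \<Longrightarrow> reduce u = reduce v"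
proof (induction rule: equivclp_induct)
  case (step y z)
  have "reduce y' = reduce z'" if "cancel_step y' z'" for y' z' :: "'a word"
    using that
  proof cases
    case (1 u x s v)
    then show ?thesis
      using push_push[OF reduced_reduce, of x s v] by (simp add: reduce_def)
  qed
  with step show ?case by metis
qed simp

lemma freely_equal_push: "freely_equal (l # w) (push l w)"
proof (cases w)
  case (Cons m w')
  show ?thesis
  proof (cases "cancelling l m")
    case True
    then have "l # w = [] @ [(fst l, snd l), (fst l, \<not> snd l)] @ w'"
      using Cons by (cases l; cases m) (auto simp: cancelling_def)
    then have "cancel_step (l # w) w'"
      using cancel_step.intros[of "[]" "fst l" "snd l" w'] by simp
    then show ?thesis using True Cons by auto
  qed (simp add: Cons)
qed simp

lemma freely_equal_reduce: "freely_equal w (reduce w)"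
proof (induction w)
  case (Cons l w)
  have "freely_equal ([l] @ w) ([l] @ reduce w)"
    using freely_equal_append[OF equivclp_refl Cons, of "[l]"] by simp
  also have "freely_equal \<dots> (reduce (l # w))"
    using freely_equal_push[of l "reduce w"] by (simp add: reduce_def)
  finally (equivclp_trans) show ?case by simp
qed (simp add: reduce_def)

lemma freely_equal_if_reduce_eq: "reduce u = reduce v \<Longrightarrow> freely_equal u v"
  by (metis freely_equal_reduce equivclp_trans equivclp_sym)

lemma reduce_reduced: "reduced w \<Longrightarrow> reduce w = w"
proof (induction w)
  case (Cons l w)
  then show ?case by (cases w) (auto simp: reduce_def)
qed (simp add: reduce_def)

lemma not_successivelyD:
  "\<not> successively P xs \<Longrightarrow> \<exists>us x y vs. xs = us @ [x, y] @ vs \<and> \<not> P x y"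
proof (induction xs rule: induct_list012)
  case (3 x y zs)
  show ?case
  proof (cases "P x y")
    case True
    with 3 obtain us x' y' vs where "y # zs = us @ [x', y'] @ vs" "\<not> P x' y'" by auto
    then have "x # y # zs = (x # us) @ [x', y'] @ vs \<and> \<not> P x' y'" by simp
    then show ?thesis by blast
  next
    case False
    then show ?thesis by (intro exI[of _ "[]"]) auto
  qed
qed auto

text \<open>A reduced word is its own normal form, so a nonempty word with normal form
  \<open>[]\<close> cannot be reduced. Applied to \<open>a_heights\<close>, this locates the subword
  to be shortened.\<close>

lemma freely_trivial_cancelling_pair:
  assumes "freely_equal w []" "w \<noteq> []"
  obtains p x s q where "w = p @ [(x, s), (x, \<not> s)] @ q"
proof -
  have "reduce w = []" using reduce_cong[OF assms(1)] by (simp add: reduce_def)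
  then have "\<not> reduced w" using assms(2) reduce_reduced by fastforce
  then obtain p l m q where "w = p @ [l, m] @ q" "cancelling l m"
    using not_successivelyD by blast
  then show ?thesis using that[of p "fst l" "snd l" q]
    by (cases l; cases m) (auto simp: cancelling_def)
qed


section \<open>Area\<close>

text \<open>Area is made relative to a target \<open>v\<close>, so that rewriting steps compose with
  additive cost; the case \<open>v = []\<close> is the bound asked for.\<close>

definition area_le :: "'g word set \<Rightarrow> nat \<Rightarrow> 'g word \<Rightarrow> 'g word \<Rightarrow> bool" where
  "area_le R k u v \<longleftrightarrow>
    (\<exists>ps. length ps \<le> k \<and> (\<forall>(r, y) \<in> set ps. r \<in> R \<union> inv_word ` R) \<and>
          freely_equal u (conj_product ps @ v))"

lemma conj_product_simps [simp]:
  "conj_product [] = []"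
  "conj_product (q # ps) = conj_word (fst q) (snd q) @ conj_product ps"
  "conj_product (ps @ qs) = conj_product ps @ conj_product qs"
  by (auto simp: conj_product_def split: prod.splits)

lemma inv_word_conj_product:
  "inv_word (conj_product ps) = conj_product (map (\<lambda>(r, y). (inv_word r, y)) (rev ps))"
  by (induction ps) (auto simp: conj_word_def)

text \<open>Conjugation acts on each factor separately once \<open>inv_word p @ p\<close> is
  inserted between neighbours; only the conjugators change, not their number.\<close>

lemma conj_product_conj:
  "freely_equal (p @ conj_product ps @ inv_word p)
    (conj_product (map (\<lambda>(r, y). (r, y @ inv_word p)) ps))"
proof (induction ps)
  case Nil
  show ?case by (simp add: freely_equal_inv_word_right)
next
  case (Cons q ps)
  obtain r y where q: "q = (r, y)" by fastforce
  have "freely_equal (p @ conj_product (q # ps) @ inv_word p)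
      ((p @ conj_word r y @ inv_word p) @ p @ conj_product ps @ inv_word p)"
    using equivclp_sym[OF freely_equal_cancel(2)
        [of "p @ conj_word r y" p "conj_product ps @ inv_word p"]] by (simp add: q)
  also have "freely_equal \<dots> ((p @ conj_word r y @ inv_word p) @
      conj_product (map (\<lambda>(r, y). (r, y @ inv_word p)) ps))"
    by (rule freely_equal_append[OF equivclp_refl Cons])
  finally (equivclp_trans) show ?case by (simp add: q conj_word_def)
qed

lemma area_le_free: "freely_equal u v \<Longrightarrow> area_le R k u v"
  unfolding area_le_def by (intro exI[of _ "[]"]) simp

lemma area_le_mono: "area_le R k u v \<Longrightarrow> k \<le> l \<Longrightarrow> area_le R l u v"
  unfolding area_le_def by (meson le_trans)

lemma area_le_trans:
  assumes "area_le R k u v" "area_le R l v w"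
  shows "area_le R (k + l) u w"
proof -
  from assms(1) obtain ps where ps: "length ps \<le> k"
    "\<forall>(r, y) \<in> set ps. r \<in> R \<union> inv_word ` R" "freely_equal u (conj_product ps @ v)"
    unfolding area_le_def by blast
  from assms(2) obtain qs where qs: "length qs \<le> l"
    "\<forall>(r, y) \<in> set qs. r \<in> R \<union> inv_word ` R" "freely_equal v (conj_product qs @ w)"
    unfolding area_le_def by blast
  have "freely_equal u (conj_product (ps @ qs) @ w)"
    using equivclp_trans[OF ps(3) freely_equal_append[OF equivclp_refl qs(3)]] by simp
  moreover have "length (ps @ qs) \<le> k + l" using ps(1) qs(1) by simp
  moreover have "\<forall>(r, y) \<in> set (ps @ qs). r \<in> R \<union> inv_word ` R" using ps(2) qs(2) by auto
  ultimately show ?thesis unfolding area_le_def by blast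
qed

lemma area_le_sym:
  assumes "area_le R k u v"
  shows "area_le R k v u"
proof -
  from assms obtain ps where ps: "length ps \<le> k"
    "\<forall>(r, y) \<in> set ps. r \<in> R \<union> inv_word ` R" "freely_equal u (conj_product ps @ v)"
    unfolding area_le_def by blast
  let ?qs = "map (\<lambda>(r, y). (inv_word r, y)) (rev ps)"
  have "freely_equal (inv_word (conj_product ps) @ u) (inv_word (conj_product ps) @ conj_product ps @ v)"
    by (rule freely_equal_append[OF equivclp_refl ps(3)])
  also have "freely_equal \<dots> v" using freely_equal_cancel(2)[of "[]"] by simp
  finally (equivclp_trans) have "freely_equal v (conj_product ?qs @ u)"
    unfolding inv_word_conj_product by (rule equivclp_sym)
  moreover have "\<forall>(r, y) \<in> set ?qs. r \<in> R \<union> inv_word ` R"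
    using ps(2) by fastforce
  ultimately show ?thesis unfolding area_le_def
    using ps(1) by (intro exI[of _ ?qs]) simp
qed

text \<open>The conjugates produced behind \<open>p\<close> are brought to the front by conjugating
  them with \<open>inv_word p\<close>, which leaves the cost unchanged.\<close>

lemma area_le_context:
  assumes "area_le R k u v"
  shows "area_le R k (p @ u @ q) (p @ v @ q)"
proof -
  from assms obtain ps where ps: "length ps \<le> k"
    "\<forall>(r, y) \<in> set ps. r \<in> R \<union> inv_word ` R" "freely_equal u (conj_product ps @ v)"
    unfolding area_le_def by blast
  let ?qs = "map (\<lambda>(r, y). (r, y @ inv_word p)) ps"
  have "freely_equal (p @ u @ q) (p @ conj_product ps @ v @ q)"
    using freely_equal_context[OF ps(3)] by simp
  also have "freely_equal \<dots> ((p @ conj_product ps @ inv_word p) @ p @ v @ q)"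
    using equivclp_sym[OF freely_equal_cancel(2)[of "p @ conj_product ps"]] by simp
  also have "freely_equal \<dots> (conj_product ?qs @ p @ v @ q)"
    by (rule freely_equal_append[OF conj_product_conj]) simp
  finally (equivclp_trans) have "freely_equal (p @ u @ q) (conj_product ?qs @ p @ v @ q)" .
  then show ?thesis unfolding area_le_def
    using ps by (intro exI[of _ ?qs]) auto
qed

lemma area_le_relator:
  assumes "r \<in> R"
  shows "area_le R 1 r []"
  unfolding area_le_def
  using assms by (intro exI[of _ "[(r, [])]"]) (auto simp: conj_word_def)

section \<open>Commutation at bounded cost\<close>

definition area_comm :: "'g word set \<Rightarrow> nat \<Rightarrow> 'g word \<Rightarrow> 'g word \<Rightarrow> bool" where
  "area_comm R k u v \<longleftrightarrow> area_le R k (u @ v) (v @ u)"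

lemma area_comm_sym: "area_comm R k u v \<Longrightarrow> area_comm R k v u"
  unfolding area_comm_def by (rule area_le_sym)

lemma area_comm_mono: "area_comm R k u v \<Longrightarrow> k \<le> l \<Longrightarrow> area_comm R l u v"
  unfolding area_comm_def by (rule area_le_mono)

lemma area_comm_append:
  assumes "area_comm R k u v" "area_comm R l u w"
  shows "area_comm R (k + l) u (v @ w)"
proof -
  have "area_le R k (u @ v @ w) (v @ u @ w)"
    using area_le_context[of R k "u @ v" "v @ u" "[]" w] assms(1) by (simp add: area_comm_def)
  moreover have "area_le R l (v @ u @ w) (v @ w @ u)"
    using area_le_context[of R l "u @ w" "w @ u" v "[]"] assms(2) by (simp add: area_comm_def)
  ultimately have "area_le R (k + l) (u @ v @ w) (v @ w @ u)" by (rule area_le_trans)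
  then show ?thesis by (simp add: area_comm_def)
qed

text \<open>The cost \<open>l\<close> is paid twice, once on each side of the commutation.\<close>

lemma area_comm_cong:
  assumes "area_comm R k u v" "area_le R l v w"
  shows "area_comm R (k + 2 * l) u w"
proof -
  have "area_le R l (u @ w) (u @ v)"
    using area_le_context[OF area_le_sym[OF assms(2)], of u "[]"] by simp
  from area_le_trans[OF this assms(1)[unfolded area_comm_def]]
  have "area_le R (l + k) (u @ w) (v @ u)" .
  moreover have "area_le R l (v @ u) (w @ u)"
    using area_le_context[OF assms(2), of "[]" u] by simp
  ultimately have "area_le R (l + k + l) (u @ w) (w @ u)" by (rule area_le_trans)
  then show ?thesis unfolding area_comm_def by (rule area_le_mono) simp
qed

lemma area_comm_free_cong:
  assumes "area_comm R k u v" "freely_equal v w"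
  shows "area_comm R k u w"
  using area_comm_cong[OF assms(1) area_le_free[OF assms(2), of R 0]] by simp

lemma area_comm_freely_trivial: "freely_equal v [] \<Longrightarrow> area_comm R k u v"
  using area_comm_free_cong[of R k u "[]" v]
  by (simp add: area_comm_def area_le_free equivclp_sym)

text \<open>Freely, \<open>u v^-1 = v^-1 (v u) v^-1\<close>; one exchange of \<open>v u\<close> for
  \<open>u v\<close> then yields \<open>v^-1 u\<close>.\<close>

lemma area_comm_inv:
  assumes "area_comm R k u v"
  shows "area_comm R k u (inv_word v)"
proof -
  have "freely_equal (u @ inv_word v) (inv_word v @ (v @ u) @ inv_word v)"
    using equivclp_sym[OF freely_equal_cancel(2)[of "[]" v "u @ inv_word v"]] by simp
  from area_le_trans[OF area_le_free[OF this, of R 0]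
      area_le_context[OF area_le_sym[OF assms[unfolded area_comm_def]]]]
  have "area_le R k (u @ inv_word v) (inv_word v @ (u @ v) @ inv_word v)" by simp
  from area_le_trans[OF this area_le_free[of _ "inv_word v @ u" R 0]]
  show ?thesis
    using freely_equal_cancel(1)[of "inv_word v @ u" v "[]"] by (simp add: area_comm_def)
qed

lemma area_comm_word:
  assumes "\<And>l. l \<in> set v \<Longrightarrow> area_comm R 1 u [l]"
  shows "area_comm R (length v) u v"
  using assms
proof (induction v)
  case Nil
  show ?case by (rule area_comm_freely_trivial) simp
next
  case (Cons l v)
  then show ?case using area_comm_append[of R 1 u "[l]" "length v" v] by simp
qed

lemma area_comm_of_comm_word:
  assumes "comm_word x y \<in> R"
  shows "area_comm R 1 x y"
proof -
  have "freely_equal (y @ x @ comm_word x y) (y @ inv_word y @ x @ y)"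
    unfolding comm_word_def by (rule freely_equal_cancel(1))
  also have "freely_equal \<dots> (x @ y)"
    using freely_equal_cancel(1)[of "[]" y "x @ y"] by simp
  finally (equivclp_trans) have "freely_equal (x @ y) (y @ x @ comm_word x y)"
    by (rule equivclp_sym)
  then have "area_le R 0 (x @ y) (y @ x @ comm_word x y)" by (rule area_le_free)
  moreover have "area_le R 1 (y @ x @ comm_word x y) (y @ x)"
    using area_le_context[OF area_le_relator[OF assms], of "y @ x" "[]"] by simp
  ultimately have "area_le R (0 + 1) (x @ y) (y @ x)" by (rule area_le_trans)
  then show ?thesis by (simp add: area_comm_def)
qed

text \<open>Equality of \<open>p^x\<close> and \<open>p^y\<close> means that \<open>p\<close>
  commutes with \<open>x y^-1\<close>: for the relator \<open>r\<close>, the word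
  \<open>x r y^-1 p\<close> is freely equal to \<open>p x y^-1\<close>.\<close>

lemma area_comm_of_conj_eq:
  assumes "conj_word p x @ inv_word (conj_word p y) \<in> R"
  shows "area_comm R 1 p (x @ inv_word y)"
proof -
  let ?r = "conj_word p x @ inv_word (conj_word p y)"
  have "freely_equal (x @ ?r @ inv_word y @ p) (p @ x @ inv_word y @ inv_word p @ y @ inv_word y @ p)"
    using freely_equal_cancel(1)[of "[]" x] by (simp add: conj_word_def)
  also have "freely_equal \<dots> (p @ x @ inv_word y @ inv_word p @ p)"
    using freely_equal_cancel(1)[of "p @ x @ inv_word y @ inv_word p" y p] by simp
  also have "freely_equal \<dots> (p @ x @ inv_word y)"
    using freely_equal_cancel(2)[of "p @ x @ inv_word y" p "[]"] by simp
  finally (equivclp_trans) have "area_le R 0 (p @ x @ inv_word y) (x @ ?r @ inv_word y @ p)"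
    by (rule area_le_free[OF equivclp_sym])
  from area_le_trans[OF this area_le_context[OF area_le_relator[OF assms]]]
  show ?thesis by (simp add: area_comm_def)
qed

text \<open>\<open>subst_word y u\<close> is a, usually not reduced, word for the power of \<open>y\<close> whose exponent is the
  exponent sum of \<open>u\<close>.\<close>

definition subst_word :: "'g \<Rightarrow> 'g word \<Rightarrow> 'g word" where
  "subst_word y = map (\<lambda>(_, s). (y, s))"

lemma subst_word_simps [simp]:
  "subst_word y [] = []"
  "subst_word y (l # w) = (y, snd l) # subst_word y w"
  "subst_word y (u @ v) = subst_word y u @ subst_word y v"
  "length (subst_word y w) = length w"
  "subst_word y (inv_word w) = inv_word (subst_word y w)"
  "subst_word y (subst_word z w) = subst_word y w"
  "fst ` set (subst_word y w) \<subseteq> {y}"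
  by (auto simp: subst_word_def inv_word_def rev_map split: prod.splits)

lemma fst_set_inv_word [simp]: "fst ` set (inv_word w) = fst ` set w"
  by (induction w) auto

lemma area_comm_letters:
  assumes "area_comm R k [(x, True)] [(y, True)]"
  shows "area_comm R k [(x, s)] [(y, t)]"
proof -
  have *: "area_comm R k [(x, True)] [(y, t)]" for t
    using assms area_comm_inv[OF assms] by (cases t) auto
  show ?thesis
    using *[of t] area_comm_sym[OF area_comm_inv[OF area_comm_sym[OF *[of t]]]] by (cases s) auto
qed

text \<open>Induction on \<open>u\<close>: the new last letter \<open>y^-s\<close> is moved left
  across the \<open>2 m\<close> letters of the old word, where \<open>m = length u\<close>, to stand
  next to the new first letter \<open>x^s\<close>. Each letter adds \<open>5 + 4 m\<close>, so the
  total is quadratic.\<close>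

lemma area_comm_subst:
  fixes p :: "'g word"
  assumes comm: "\<And>x. x \<in> X \<Longrightarrow> area_comm R 1 [(x, True)] [(y, True)]"
    and p: "\<And>x. x \<in> X \<Longrightarrow> area_comm R 3 p [(x, True), (y, False)]"
    and u: "fst ` set u \<subseteq> X"
  shows "area_comm R (20 * length u ^ 2) p (u @ inv_word (subst_word y u))"
  using u
proof (induction u)
  case Nil
  show ?case by (rule area_comm_freely_trivial) simp
next
  case (Cons l u)
  obtain x s where l: "l = (x, s)" by fastforce
  with Cons.prems have x: "x \<in> X" by simp
  let ?z = "u @ inv_word (subst_word y u)" and ?m = "length u"
  \<comment> \<open>For a negative letter, inverting \<open>x y^-1\<close> gives
    \<open>y x^-1\<close>, whose letters must still be exchanged; this raises the cost from 3 to
    \<open>3 + 2 * 1\<close>.\<close>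
  have xy: "area_comm R 5 p [(x, s), (y, \<not> s)]"
  proof (cases s)
    case True
    then show ?thesis using area_comm_mono[OF p[OF x], of 5] by simp
  next
    case False
    have "area_comm R 3 p [(y, True), (x, False)]"
      using area_comm_inv[OF p[OF x]] by simp
    moreover have "area_le R 1 [(y, True), (x, False)] [(x, False), (y, True)]"
      using area_comm_sym[OF area_comm_letters[OF comm[OF x], of False True]]
      by (simp add: area_comm_def)
    ultimately have "area_comm R (3 + 2 * 1) p [(x, False), (y, True)]" by (rule area_comm_cong)
    then show ?thesis using False by simp
  qed
  have "area_comm R (length ?z) [(y, \<not> s)] ?z"
  proof (rule area_comm_word)
    fix m assume m: "m \<in> set ?z"
    obtain g t where g: "m = (g, t)" by fastforce
    have "fst ` set ?z = fst ` set u \<union> fst ` set (subst_word y u)" by (simp add: image_Un)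
    also have "\<dots> \<subseteq> X \<union> {y}" using Cons.prems subst_word_simps(7) by (intro Un_mono) simp_all
    finally have "g \<in> X \<or> g = y" using imageI[OF m, of fst] by (auto simp: g)
    then show "area_comm R 1 [(y, \<not> s)] [m]"
    proof
      assume "g \<in> X"
      from area_comm_sym[OF area_comm_letters[OF comm[OF this]]] show ?thesis by (simp add: g)
    next
      assume "g = y"
      then show ?thesis
        unfolding area_comm_def
        by (intro area_le_free freely_equal_if_reduce_eq)
           (auto simp: g reduce_def cancelling_def)
    qed
  qed
  then have move: "area_le R (2 * ?m) ([(x, s), (y, \<not> s)] @ ?z) ([(x, s)] @ ?z @ [(y, \<not> s)])"
    using area_le_context[of R "2 * ?m" "[(y, \<not> s)] @ ?z" "?z @ [(y, \<not> s)]" "[(x, s)]" "[]"]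
    by (simp add: area_comm_def mult_2)
  have "area_comm R (5 + 20 * ?m ^ 2) p ([(x, s), (y, \<not> s)] @ ?z)"
    using Cons by (intro area_comm_append[OF xy] Cons.IH) simp
  from area_comm_cong[OF this move]
  have "area_comm R (5 + 20 * ?m ^ 2 + 2 * (2 * ?m)) p ((l # u) @ inv_word (subst_word y (l # u)))"
    by (simp add: l)
  then show ?case
    by (rule area_comm_mono) (simp add: power2_eq_square algebra_simps)
qed


section \<open>Normal closures and words\<close>

lemma inv_free_class: "inv\<^bsub>free_group\<^esub> (free_class w) = free_class (inv_word w)"
proof (rule group.inv_equality[OF group_free_group])
  show "free_class (inv_word w) \<otimes>\<^bsub>free_group\<^esub> free_class w = \<one>\<^bsub>free_group\<^esub>"
    unfolding mult_free_group
    using freely_equal_inv_word[of w] by (simp add: free_class_eq_iff free_group_def)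
qed (auto simp: free_group_def)

text \<open>The classes of words satisfying \<open>P\<close> form a normal subgroup containing the
  relators, hence containing \<open>relator_subgroup R\<close>, where the class of a null word
  lies.\<close>

lemma word_value_one_induct:
  fixes R :: "'g word set"
  assumes one: "word_value R w = \<one>\<^bsub>presented_group R\<^esub>"
    and rel: "\<And>r. r \<in> R \<Longrightarrow> P r"
    and nil: "P []"
    and free: "\<And>u v. P u \<Longrightarrow> freely_equal u v \<Longrightarrow> P v"
    and app: "\<And>u v. P u \<Longrightarrow> P v \<Longrightarrow> P (u @ v)"
    and inv: "\<And>u. P u \<Longrightarrow> P (inv_word u)"
    and conj: "\<And>u v. P u \<Longrightarrow> P (v @ u @ inv_word v)"
  shows "P w"
proof -
  let ?N = "free_class ` Collect P"
  have "subgroup ?N free_group"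
  proof (rule group.subgroupI[OF group_free_group])
    show "?N \<subseteq> carrier free_group" by (auto simp: free_group_def)
    show "?N \<noteq> {}" using nil by blast
    show "inv\<^bsub>free_group\<^esub> X \<in> ?N" if "X \<in> ?N" for X
      using that by (auto simp: inv_free_class inv)
    show "X \<otimes>\<^bsub>free_group\<^esub> Y \<in> ?N" if "X \<in> ?N" "Y \<in> ?N" for X Y
      using that by (auto simp: mult_free_group app)
  qed
  then have "?N \<lhd> free_group"
  proof (rule group.normal_invI[OF group_free_group])
    fix X H :: "'g word set" assume "X \<in> carrier free_group" "H \<in> ?N"
    then obtain v u where "X = free_class v" "H = free_class u" "P u"
      by (auto simp: free_group_def)
    then show "X \<otimes>\<^bsub>free_group\<^esub> H \<otimes>\<^bsub>free_group\<^esub> inv\<^bsub>free_group\<^esub> X \<in> ?N"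
      using conj[of u v] by (simp add: inv_free_class mult_free_group)
  qed
  then have sub: "relator_subgroup R \<subseteq> ?N"
    using rel unfolding relator_subgroup_def normal_closure_def by blast
  have "relator_subgroup R #>\<^bsub>free_group\<^esub> free_class w = relator_subgroup R"
    using one by (simp add: word_value_def presented_group_def FactGroup_def)
  moreover have "free_class w \<in> relator_subgroup R #>\<^bsub>free_group\<^esub> free_class w"
    by (rule group.rcos_self[OF group_free_group _ normal_imp_subgroup[OF relator_subgroup_normal]])
       (simp add: free_group_def)
  ultimately have "free_class w \<in> ?N" using sub by blast
  then obtain u where "P u" "free_class u = free_class w" by auto
  then show ?thesis using free[of u w] by (simp add: free_class_eq_iff)
qed


section \<open>Stallings' group\<close>

definition exp_sum :: "gen word \<Rightarrow> int" where
  "exp_sum w = (\<Sum>(x, s)\<leftarrow>w. if x = gen_a then 0 else if s then 1 else - 1)"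

lemma exp_sum_simps [simp]:
  "exp_sum [] = 0"
  "exp_sum ((x, s) # w) = (if x = gen_a then 0 else if s then 1 else - 1) + exp_sum w"
  "exp_sum (u @ v) = exp_sum u + exp_sum v"
  by (simp_all add: exp_sum_def)

lemma exp_sum_inv_word [simp]: "exp_sum (inv_word w) = - exp_sum w"
  by (induction w) auto

text \<open>The homomorphism to the free group on \<open>a\<close> and \<open>t\<close> sending \<open>b, c, d, e\<close> to \<open>t\<close>, written in the
  free basis \<open>t\<^sup>k a t\<^sup>-\<^sup>k\<close> of the kernel of the exponent sum of \<open>t\<close>.\<close>

fun a_heights :: "int \<Rightarrow> gen word \<Rightarrow> int word" where
  "a_heights k [] = []"
| "a_heights k ((x, s) # w) =
    (if x = gen_a then (k, s) # a_heights k w else a_heights (if s then k + 1 else k - 1) w)"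

lemma a_heights_append [simp]:
  "a_heights k (u @ v) = a_heights k u @ a_heights (k + exp_sum u) v"
  by (induction u arbitrary: k) (auto simp: algebra_simps)

text \<open>The inverse word retraces the heights from the final one; each \<open>a\<close> is met
  at the same height because \<open>a\<close> itself does not change it.\<close>

lemma a_heights_inv_word:
  "a_heights (k + exp_sum w) (inv_word w) = inv_word (a_heights k w)"
proof (induction w arbitrary: k)
  case (Cons l w)
  obtain x s where l: "l = (x, s)" by fastforce
  show ?case
    using Cons.IH[of k] Cons.IH[of "k + 1"] Cons.IH[of "k - 1"] by (auto simp: l algebra_simps)
qed simp

lemma a_heights_eq_Nil: "gen_a \<notin> fst ` set w \<Longrightarrow> a_heights k w = []"
  by (induction w arbitrary: k) auto

text \<open>Isolates the first \<open>a\<close> of \<open>w\<close>. For two consecutive entries of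
  equal height it shows that the word between the two letters \<open>a\<close> has exponent sum
  0.\<close>

lemma a_heights_eq_Cons:
  assumes "a_heights k w = (j, s) # v"
  obtains u q where "w = u @ [(gen_a, s)] @ q" "gen_a \<notin> fst ` set u" "j = k + exp_sum u"
    "a_heights j q = v"
  using assms
proof (induction w arbitrary: k thesis)
  case (Cons l w)
  obtain x t where l: "l = (x, t)" by fastforce
  show ?case
  proof (cases "x = gen_a")
    case True
    with Cons.prems l show ?thesis by (intro Cons.prems(1)[of "[]" w]) auto
  next
    case False
    let ?k = "if t then k + 1 else k - 1"
    have "a_heights ?k w = (j, s) # v" using Cons.prems(2) False by (simp add: l)
    then obtain u q where "w = u @ [(gen_a, s)] @ q"
      "gen_a \<notin> fst ` set u" "j = ?k + exp_sum u" "a_heights j q = v" by (rule Cons.IH[rotated])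
    with False show ?thesis by (intro Cons.prems(1)[of "l # u" q]) (auto simp: l)
  qed
qed simp

lemma a_heights_eq_append:
  assumes "a_heights k w = u @ v"
  obtains p q where "w = p @ q" "a_heights k p = u" "a_heights (k + exp_sum p) q = v"
  using assms
proof (induction u arbitrary: k w thesis)
  case Nil
  then show ?case using Nil(1)[of "[]" w] by simp
next
  case (Cons l u)
  obtain j s where l: "l = (j, s)" by fastforce
  have "a_heights k w = (j, s) # (u @ v)" using Cons.prems(2) l by simp
  then obtain p q where 1: "w = p @ [(gen_a, s)] @ q"
    "gen_a \<notin> fst ` set p" "j = k + exp_sum p" "a_heights j q = u @ v"
    by (rule a_heights_eq_Cons)
  from 1(4) obtain p' q' where "q = p' @ q'" "a_heights j p' = u"
    "a_heights (j + exp_sum p') q' = v" by (rule Cons.IH[rotated])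
  with 1 show ?case
    by (intro Cons.prems(1)[of "p @ [(gen_a, s)] @ p'" q']) (auto simp: a_heights_eq_Nil l add.assoc)
qed

definition proj :: "'g set \<Rightarrow> 'g word \<Rightarrow> 'g word" where
  "proj X w = filter (\<lambda>l. fst l \<in> X) w"

lemma proj_simps [simp]:
  "proj X [] = []"
  "proj X (l # w) = (if fst l \<in> X then l # proj X w else proj X w)"
  "proj X (u @ v) = proj X u @ proj X v"
  "set (proj X w) = {l \<in> set w. fst l \<in> X}"
  "length (proj X w) \<le> length w"
  by (auto simp: proj_def)

lemma proj_inv_word [simp]: "proj X (inv_word w) = inv_word (proj X w)"
  by (induction w) auto

text \<open>Triviality of the image of a word under the embedding of Stallings' group into a product of
  three free groups.\<close>

definition invisible :: "gen word \<Rightarrow> bool" where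
  "invisible w \<longleftrightarrow> exp_sum w = 0 \<and> (\<forall>k. freely_equal (a_heights k w) []) \<and>
     freely_equal (proj {gen_b, gen_c} w) [] \<and> freely_equal (proj {gen_d, gen_e} w) []"

lemma free_invariants:
  assumes "freely_equal u v"
  shows "exp_sum u = exp_sum v \<and> freely_equal (a_heights k u) (a_heights k v) \<and>
    freely_equal (proj X u) (proj X v)"
  using assms
proof (induction rule: equivclp_induct)
  case (step y z)
  have "exp_sum y' = exp_sum z' \<and> freely_equal (a_heights k y') (a_heights k z') \<and>
      freely_equal (proj X y') (proj X z')" if "cancel_step y' z'" for y' z'
    using that
  proof cases
    case (1 u x s v)
    \<comment> \<open>The pair has exponent sum 0, so the heights in \<open>v\<close> are
      unaffected; if its letter is \<open>a\<close>, both occurrences have the same height and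
      cancel.\<close>
    show ?thesis using freely_equal_cancel(1)[of "a_heights k u" "[(k + exp_sum u, s)]" "a_heights (k + exp_sum u) v"]
        freely_equal_cancel(1)[of "proj X u" "[(x,s)]" "proj X v"]
      by (auto simp: 1)
  qed
  then have "exp_sum y = exp_sum z \<and> freely_equal (a_heights k y) (a_heights k z) \<and>
      freely_equal (proj X y) (proj X z)" using step(2) by (metis equivclp_sym)
  with step.IH show ?case by (metis equivclp_trans)
qed simp

lemma freely_trivial_append: "freely_equal u [] \<Longrightarrow> freely_equal v [] \<Longrightarrow> freely_equal (u @ v) []"
  using freely_equal_append[of u "[]" v "[]"] by simp

lemma freely_trivial_inv: "freely_equal u [] \<Longrightarrow> freely_equal (inv_word u) []"
  using freely_equal_inv_word_cong[of u "[]"] by simp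

lemma freely_trivial_conj: "freely_equal u [] \<Longrightarrow> freely_equal (v @ u @ inv_word v) []"
  using freely_equal_context[of u "[]" v "inv_word v"] freely_equal_inv_word_right[of v]
  by (simp add: equivclp_trans)

text \<open>In a conjugation relator \<open>a\<close> and its inverse occur at the same height, and
  the other letters cancel in each projection. A commutator relator has one letter from each of the
  two pairs, so each projection sees only one of them.\<close>

lemma invisible_relator: "r \<in> stallings_relators \<Longrightarrow> invisible r"
  unfolding stallings_relators_def Let_def invisible_def
  by (auto simp: conj_word_def comm_word_def intro!: freely_equal_if_reduce_eq)
     (auto simp: reduce_def cancelling_def)

lemma invisible_of_word_value:
  assumes "word_value stallings_relators w = \<one>\<^bsub>stallings_group\<^esub>"
  shows "invisible w"
  using assms unfolding stallings_group_def
proof (rule word_value_one_induct)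
  show "invisible v" if "invisible u" "freely_equal u v" for u v
    using that free_invariants[OF that(2)] unfolding invisible_def
    by (metis equivclp_sym equivclp_trans)
  show "invisible (u @ v)" if "invisible u" "invisible v" for u v
    using that by (auto simp: invisible_def intro!: freely_trivial_append)
  show "invisible (inv_word u)" if "invisible u" for u
    using that a_heights_inv_word[of _ u]
    by (auto simp: invisible_def intro!: freely_trivial_inv)
  \<comment> \<open>As \<open>u\<close> has exponent sum 0, the heights of \<open>inv_word v\<close>
    start where those of \<open>v\<close> end, so the two contributions are mutually
    inverse.\<close>
  show "invisible (v @ u @ inv_word v)" if "invisible u" for u v
    using that
    by (auto simp: invisible_def a_heights_inv_word intro!: freely_trivial_conj)
qed (auto simp: invisible_relator, auto simp: invisible_def)

abbreviation (input) "S \<equiv> stallings_relators"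

section \<open>Quadratic commutation costs in Stallings' group\<close>

lemma stallings_comm:
  assumes "x \<in> {gen_b, gen_c}" "y \<in> {gen_d, gen_e}"
  shows "area_comm S 1 [(x, s)] [(y, t)]"
proof -
  have "comm_word (letter x) (letter y) \<in> S \<or> comm_word (letter y) (letter x) \<in> S"
    using assms by (auto simp: stallings_relators_def Let_def)
  then have "area_comm S 1 (letter x) (letter y)"
    by (elim disjE area_comm_of_comm_word area_comm_sym[OF area_comm_of_comm_word])
  then show ?thesis by (rule area_comm_letters)
qed

text \<open>The relators say that \<open>a\<close> commutes with \<open>b c^-1\<close>,
  \<open>c d^-1\<close> and \<open>d e^-1\<close>. Telescoping and inverting give the rest; the
  longest chain, for \<open>b e^-1\<close>, uses all three.\<close>

lemma stallings_a_comm: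
  "area_comm S 3 [(gen_a, True)] [(gen_b, True), (gen_d, False)]"
  "area_comm S 3 [(gen_a, True)] [(gen_c, True), (gen_d, False)]"
  "area_comm S 3 [(gen_a, True)] [(gen_d, True), (gen_b, False)]"
  "area_comm S 3 [(gen_a, True)] [(gen_e, True), (gen_b, False)]"
proof -
  let ?C = "area_comm S"
  have 1: "?C 1 [(gen_a, True)] [(gen_b, True), (gen_c, False)]"
    using area_comm_of_conj_eq[of "letter gen_a" "letter gen_b" "letter gen_c" S]
    by (simp add: stallings_relators_def Let_def)
  have 2: "?C 1 [(gen_a, True)] [(gen_c, True), (gen_d, False)]"
    using area_comm_of_conj_eq[of "letter gen_a" "letter gen_c" "letter gen_d" S]
    by (simp add: stallings_relators_def Let_def)
  have 3: "?C 1 [(gen_a, True)] [(gen_d, True), (gen_e, False)]"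
    using area_comm_of_conj_eq[of "letter gen_a" "letter gen_d" "letter gen_e" S]
    by (simp add: stallings_relators_def Let_def)
  have tr: "?C (k + l) [(gen_a, True)] [(x, True), (z, False)]"
    if "?C k [(gen_a, True)] [(x, True), (y, False)]" "?C l [(gen_a, True)] [(y, True), (z, False)]"
    for k l x y z
  proof (rule area_comm_free_cong[OF area_comm_append[OF that]])
    show "freely_equal ([(x, True), (y, False)] @ [(y, True), (z, False)]) [(x, True), (z, False)]"
      using freely_equal_cancel(2)[of "[(x, True)]" "[(y, True)]" "[(z, False)]"] by simp
  qed
  have bd: "?C 2 [(gen_a, True)] [(gen_b, True), (gen_d, False)]"
    using tr[OF 1 2] by (simp add: numeral_2_eq_2)
  have be: "?C 3 [(gen_a, True)] [(gen_b, True), (gen_e, False)]"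
    using tr[OF bd 3] by simp
  show "?C 3 [(gen_a, True)] [(gen_b, True), (gen_d, False)]"
    using area_comm_mono[OF bd] by simp
  show "?C 3 [(gen_a, True)] [(gen_c, True), (gen_d, False)]"
    using area_comm_mono[OF 2] by simp
  show "?C 3 [(gen_a, True)] [(gen_d, True), (gen_b, False)]"
    using area_comm_mono[OF area_comm_inv[OF bd]] by simp
  show "?C 3 [(gen_a, True)] [(gen_e, True), (gen_b, False)]"
    using area_comm_inv[OF be] by simp
qed

text \<open>The substituted letter has to commute with the letters of \<open>u\<close>, hence
  \<open>d\<close> for words in \<open>b, c\<close>, and \<open>b\<close> for words in
  \<open>d, e\<close> below.\<close>

lemma stallings_subst_d:
  assumes "fst ` set u \<subseteq> {gen_b, gen_c}"
  shows "area_comm S (20 * length u ^ 2) (letter gen_a) (u @ inv_word (subst_word gen_d u))"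
  by (rule area_comm_subst[OF _ _ assms]) (use stallings_comm stallings_a_comm in auto)

lemma stallings_subst_b:
  assumes "fst ` set u \<subseteq> {gen_d, gen_e}"
  shows "area_comm S (20 * length u ^ 2) (letter gen_a) (u @ inv_word (subst_word gen_b u))"
  by (rule area_comm_subst[OF _ _ assms])
     (use area_comm_sym[OF stallings_comm] stallings_a_comm in auto)

text \<open>Insertion sort: a new first letter \<open>d\<close> or \<open>e\<close> crosses at most
  \<open>length u\<close> letters \<open>b\<close> or \<open>c\<close>.\<close>

lemma stallings_sort:
  assumes "gen_a \<notin> fst ` set u"
  shows "area_le S (length u ^ 2) u (proj {gen_b, gen_c} u @ proj {gen_d, gen_e} u)"
  using assms
proof (induction u)
  case Nil
  show ?case by (simp add: area_le_free)
next
  case (Cons l u)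
  let ?p = "proj {gen_b, gen_c} u" and ?q = "proj {gen_d, gen_e} u"
  have IH: "area_le S (length u ^ 2) (l # u) (l # ?p @ ?q)"
    using area_le_context[OF Cons.IH, of "[l]" "[]"] Cons.prems by simp
  have "area_le S (length u) (l # ?p @ ?q)
      (proj {gen_b, gen_c} (l # u) @ proj {gen_d, gen_e} (l # u))"
  proof (cases "fst l \<in> {gen_b, gen_c}")
    case True
    then show ?thesis by (auto intro: area_le_free)
  next
    case False
    with Cons.prems have l: "fst l \<in> {gen_d, gen_e}" by (cases "fst l") auto
    have "area_comm S (length ?p) [l] ?p"
    proof (rule area_comm_word)
      fix m assume "m \<in> set ?p"
      with l show "area_comm S 1 [l] [m]"
        using area_comm_sym[OF stallings_comm[of "fst m" "fst l" "snd m" "snd l"]] by simp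
    qed
    then have "area_comm S (length u) [l] ?p" by (rule area_comm_mono) simp
    then show ?thesis
      using l area_le_context[of S "length u" "[l] @ ?p" "?p @ [l]" "[]" ?q]
      by (auto simp: area_comm_def)
  qed
  from area_le_trans[OF IH this] show ?case
    by (rule area_le_mono) (simp add: power2_eq_square)
qed

lemma subst_word_freely_trivial:
  assumes "gen_a \<notin> fst ` set u" "exp_sum u = 0"
  shows "freely_equal (subst_word y u) []"
proof -
  \<comment> \<open>The normal form of \<open>y^k\<close>; pushing a letter onto it shifts
    \<open>k\<close> by one.\<close>
  define pow where "pow k = (if k \<ge> 0 then replicate (nat k) (y, True)
    else replicate (nat (- k)) (y, False))" for k :: int
  have T: "push (y, True) (pow k) = pow (k + 1)" for k
  proof (cases "k \<ge> 0")
    case True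
    then show ?thesis
      by (cases "nat k") (auto simp: pow_def cancelling_def nat_add_distrib)
  next
    case False
    then obtain m where m: "nat (- k) = Suc m" by (metis gr0_implies_Suc neg_0_less_iff_less not_le zero_less_nat_eq)
    then have "nat (- (k + 1)) = m" by linarith
    then show ?thesis using m False by (auto simp: pow_def cancelling_def)
  qed
  have F: "push (y, False) (pow k) = pow (k - 1)" for k
  proof (cases "k > 0")
    case False
    then have "nat (- (k - 1)) = Suc (nat (- k))" by linarith
    with False show ?thesis
      by (cases "nat (- k)") (auto simp: pow_def cancelling_def)
  next
    case True
    then obtain m where m: "nat k = Suc m" by (metis gr0_implies_Suc zero_less_nat_eq)
    then have "nat (k - 1) = m" by linarith
    then show ?thesis using m True by (auto simp: pow_def cancelling_def)
  qed
  have "reduce (subst_word y u) = pow (exp_sum u)"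
    using assms(1)
  proof (induction u)
    case (Cons l u)
    then show ?case using T[of "exp_sum u"] F[of "exp_sum u"]
      by (cases l) (auto simp: reduce_def add.commute)
  qed (simp add: reduce_def pow_def)
  then show ?thesis
    using assms(2) by (intro freely_equal_if_reduce_eq) (simp add: pow_def reduce_def)
qed

text \<open>The powers of \<open>d\<close> and \<open>b\<close> in the factorisation are represented
  by \<open>subst_word\<close>: the sorted word \<open>?v @ ?w\<close> is split using
  \<open>?d ?v\<close>, \<open>?d ?w\<close> and \<open>?b ?w\<close>. Three factors cost
  \<open>20 n^2\<close> each, with \<open>n = length u\<close>, and the factor
  \<open>?d ?v @ ?d ?w\<close> is free.\<close>

lemma stallings_a_comm_exp_sum_zero:
  assumes "gen_a \<notin> fst ` set u" "exp_sum u = 0"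
  shows "area_comm S (62 * length u ^ 2) (letter gen_a) u"
proof -
  let ?v = "proj {gen_b, gen_c} u" and ?w = "proj {gen_d, gen_e} u" and ?n = "length u"
  let ?C = "area_comm S (20 * ?n ^ 2) (letter gen_a)"
  let ?d = "subst_word gen_d" and ?b = "subst_word gen_b"
  have len: "length ?v \<le> ?n" "length ?w \<le> ?n" by simp_all
  have mono: "20 * m ^ 2 \<le> 20 * ?n ^ 2" if "m \<le> ?n" for m
    using power_mono[OF that, of 2] by simp
  have 1: "?C (?v @ inv_word (?d ?v))"
    by (rule area_comm_mono[OF stallings_subst_d mono[OF len(1)]]) auto
  \<comment> \<open>\<open>stallings_subst_d\<close> is applied to a word in \<open>b\<close> alone,
    which trades powers of \<open>b\<close> for powers of \<open>d\<close>.\<close>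
  have "?C (inv_word (?b ?w) @ inv_word (?d (inv_word (?b ?w))))"
    by (rule area_comm_mono[OF stallings_subst_d mono])
       (use len subst_word_simps(7)[of gen_b ?w] in \<open>auto simp: subset_iff\<close>)
  from area_comm_inv[OF this] have 2: "?C (inv_word (?d ?w) @ ?b ?w)" by simp
  have "?C (inv_word ?w @ inv_word (?b (inv_word ?w)))"
    by (rule area_comm_mono[OF stallings_subst_b mono]) (use len in auto)
  from area_comm_inv[OF this] have 3: "?C (inv_word (?b ?w) @ ?w)" by simp
  have es: "exp_sum (?v @ ?w) = exp_sum u" using assms(1)
    by (induction u) (auto, metis gen.exhaust)
  have "freely_equal (?d (?v @ ?w)) []"
    using es assms by (intro subst_word_freely_trivial) auto
  then have 4: "area_comm S 0 (letter gen_a) (?d ?v @ ?d ?w)"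
    by (intro area_comm_freely_trivial) simp
  have "area_comm S (20 * ?n ^ 2 + (0 + (20 * ?n ^ 2 + 20 * ?n ^ 2))) (letter gen_a)
    ((?v @ inv_word (?d ?v)) @ (?d ?v @ ?d ?w) @ (inv_word (?d ?w) @ ?b ?w) @ (inv_word (?b ?w) @ ?w))"
    by (intro area_comm_append 1 2 3 4)
  then have "area_comm S (60 * ?n ^ 2) (letter gen_a) (?v @ ?w)"
  proof (rule area_comm_mono[OF area_comm_free_cong])
    have "freely_equal ((?v @ inv_word (?d ?v)) @ (?d ?v @ ?d ?w) @ (inv_word (?d ?w) @ ?b ?w) @ (inv_word (?b ?w) @ ?w))
      (?v @ ?d ?w @ inv_word (?d ?w) @ ?b ?w @ inv_word (?b ?w) @ ?w)"
      using freely_equal_cancel(2)[of ?v "?d ?v"] by simp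
    also have "freely_equal \<dots> (?v @ ?b ?w @ inv_word (?b ?w) @ ?w)"
      by (rule freely_equal_cancel(1))
    also have "freely_equal \<dots> (?v @ ?w)" by (rule freely_equal_cancel(1))
    finally (equivclp_trans) show "freely_equal ((?v @ inv_word (?d ?v)) @ (?d ?v @ ?d ?w) @ (inv_word (?d ?w) @ ?b ?w) @ (inv_word (?b ?w) @ ?w)) (?v @ ?w)" .
  qed simp
  \<comment> \<open>Undoing the sorting on both sides adds \<open>2 n^2\<close> to
    \<open>60 n^2\<close>.\<close>
  from area_comm_cong[OF this area_le_sym[OF stallings_sort[OF assms(1)]]]
  show ?thesis by simp
qed

lemma stallings_pinch:
  assumes "gen_a \<notin> fst ` set u" "exp_sum u = 0"
  shows "area_le S (62 * length u ^ 2) ([(gen_a, s)] @ u @ [(gen_a, \<not> s)]) u"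
proof -
  have "area_comm S (62 * length u ^ 2) [(gen_a, s)] u"
    using stallings_a_comm_exp_sum_zero[OF assms]
      area_comm_sym[OF area_comm_inv[OF area_comm_sym[OF stallings_a_comm_exp_sum_zero[OF assms]]]]
    by (cases s) auto
  then have "area_le S (62 * length u ^ 2) (([(gen_a, s)] @ u) @ [(gen_a, \<not> s)])
      (u @ [(gen_a, s)] @ [(gen_a, \<not> s)])"
    using area_le_context[of S _ "[(gen_a, s)] @ u" "u @ [(gen_a, s)]" "[]" "[(gen_a, \<not> s)]"]
    by (simp add: area_comm_def)
  moreover have "area_le S 0 (u @ [(gen_a, s)] @ [(gen_a, \<not> s)]) u"
    using freely_equal_cancel(1)[of u "[(gen_a, s)]" "[]"] by (intro area_le_free) simp
  ultimately have "area_le S (62 * length u ^ 2 + 0) (([(gen_a, s)] @ u) @ [(gen_a, \<not> s)]) u"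
    by (rule area_le_trans)
  then show ?thesis by simp
qed

section \<open>Elimination of the letter \<open>a\<close> and the cubic bound\<close>

text \<open>The length bound \<open>n\<close> stays fixed during the induction, so each elimination
  costs at most \<open>62 n^2\<close> and shortens \<open>w\<close> by 2; the last
  \<open>n^2\<close> pays for sorting the word left without \<open>a\<close>.\<close>

lemma invisible_area:
  assumes "invisible w" "length w \<le> n"
  shows "area_le S (62 * n ^ 2 * length w + n ^ 2) w []"
  using assms
proof (induction "length w" arbitrary: w rule: less_induct)
  case less
  show ?case
  proof (cases "gen_a \<in> fst ` set w")
    case False
    have "freely_equal (proj {gen_b, gen_c} w @ proj {gen_d, gen_e} w) []"
      using less.prems(1) unfolding invisible_def by (intro freely_trivial_append) auto
    from area_le_trans[OF stallings_sort[OF False] area_le_free[OF this, of S 0]]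
    have "area_le S (length w ^ 2) w []" by simp
    then show ?thesis
      using power_mono[OF less.prems(2), of 2] by (rule area_le_mono[OF _ trans_le_add2]) simp
  next
    case True
    then have "a_heights 0 w \<noteq> []"
      by (metis (no_types, lifting) a_heights.simps(2) a_heights_append append_is_Nil_conv imageE
          list.distinct(1) prod.collapse split_list)
    moreover have "freely_equal (a_heights 0 w) []"
      using less.prems(1) by (simp add: invisible_def)
    ultimately obtain P j s Q where "a_heights 0 w = P @ [(j, s), (j, \<not> s)] @ Q"
      using freely_trivial_cancelling_pair by metis
    then obtain p1 r1 where 0: "w = p1 @ r1" "a_heights 0 p1 = P"
      "a_heights (0 + exp_sum p1) r1 = [(j, s), (j, \<not> s)] @ Q"
      by (rule a_heights_eq_append)
    then have 1: "w = p1 @ r1" "a_heights (exp_sum p1) r1 = (j, s) # (j, \<not> s) # Q" by simp_all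
    obtain p2 r2 where 2: "r1 = p2 @ [(gen_a, s)] @ r2" "a_heights j r2 = (j, \<not> s) # Q"
      using a_heights_eq_Cons[OF 1(2)] by metis
    \<comment> \<open>Both entries of the cancelling pair have height \<open>j\<close>, whence
      \<open>j = j + exp_sum u\<close>.\<close>
    obtain u q where 3: "r2 = u @ [(gen_a, \<not> s)] @ q" "gen_a \<notin> fst ` set u" "j = j + exp_sum u"
      using a_heights_eq_Cons[OF 2(2)] by metis
    define p where "p = p1 @ p2"
    have w: "w = p @ ([(gen_a, s)] @ u @ [(gen_a, \<not> s)]) @ q" by (simp add: 1 2 3 p_def)
    have u: "exp_sum u = 0" using 3(3) by simp
    let ?w = "p @ u @ q"
    \<comment> \<open>Removing the two letters \<open>a\<close> removes an adjacent inverse pair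
      from the heights, and the projections do not see it.\<close>
    have "freely_equal (a_heights k ?w) (a_heights k w)" for k
      using freely_equal_cancel(1)[of "a_heights k p" "[(k + exp_sum p, s)]"] u
      by (simp add: w a_heights_eq_Nil[OF 3(2)] equivclp_sym)
    moreover have "freely_equal (a_heights k w) []" for k
      using less.prems(1) by (simp add: invisible_def)
    ultimately have "freely_equal (a_heights k ?w) []" for k by (rule equivclp_trans)
    then have "invisible ?w" using less.prems(1) u by (simp add: invisible_def w)
    moreover have len: "length w = length ?w + 2" by (simp add: w)
    ultimately have IH: "area_le S (62 * n ^ 2 * length ?w + n ^ 2) ?w []"
      using less.prems(2) by (intro less.hyps) auto
    have "length u \<le> n" using less.prems(2) len by simp
    then have "62 * length u ^ 2 \<le> 62 * n ^ 2" by (simp add: power_mono)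
    then have "area_le S (62 * n ^ 2) w ?w"
      unfolding w by (intro area_le_context area_le_mono[OF stallings_pinch[OF 3(2) u]])
    from area_le_trans[OF this IH] show ?thesis
      by (rule area_le_mono) (simp add: len algebra_simps)
  qed
qed

theorem mainTheorem4:
  shows "\<exists>K::real. K > 0 \<and>
    (\<forall>w :: gen word.
      length w \<ge> 1 \<and> word_value stallings_relators w = \<one>\<^bsub>stallings_group\<^esub> \<longrightarrow>
      (\<exists>ps. real (length ps) \<le> K * real (length w) ^ 3 \<and>
            (\<forall>(r, y) \<in> set ps. r \<in> stallings_relators \<union> inv_word ` stallings_relators) \<and>
            freely_equal w (conj_product ps)))"
proof (intro exI[of _ 63] conjI allI impI)
  fix w :: "gen word"
  let ?n = "length w"
  assume w: "?n \<ge> 1 \<and> word_value stallings_relators w = \<one>\<^bsub>stallings_group\<^esub>"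
  \<comment> \<open>The sorting term is absorbed into the cubic one, giving
    \<open>63 = 62 + 1\<close>.\<close>
  have "?n ^ 2 * 1 \<le> ?n ^ 2 * ?n" using w by (intro mult_left_mono) auto
  then have "62 * ?n ^ 2 * ?n + ?n ^ 2 \<le> 63 * ?n ^ 3"
    by (simp add: power2_eq_square power3_eq_cube)
  from area_le_mono[OF invisible_area[OF invisible_of_word_value order_refl] this] w
  have "area_le stallings_relators (63 * ?n ^ 3) w []" by blast
  then obtain ps where "length ps \<le> 63 * ?n ^ 3"
    "\<forall>(r, y) \<in> set ps. r \<in> stallings_relators \<union> inv_word ` stallings_relators"
    "freely_equal w (conj_product ps)"
    unfolding area_le_def by auto
  moreover from this(1) have "real (length ps) \<le> 63 * real ?n ^ 3"
    by (metis of_nat_le_iff of_nat_mult of_nat_numeral of_nat_power)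
  ultimately show "\<exists>ps. real (length ps) \<le> 63 * real ?n ^ 3 \<and>
      (\<forall>(r, y) \<in> set ps. r \<in> stallings_relators \<union> inv_word ` stallings_relators) \<and>
      freely_equal w (conj_product ps)" by blast
qed simp

end
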